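(* Let $0 < \varepsilon, \delta < 1$, let $(U, \mathcal{R})$ be a set system with $\mathcal{R}$ finite, and let $n$ be the stream length. Then: (1) $\mathsf{BernoulliSample}$ with parameter $p \geq 10\cdot\frac{\ln|\mathcal{R}| + \ln(4/\delta)}{\varepsilon^2 n}$ is $(\varepsilon,\delta)$-robust with respect to $(U,\mathcal{R})$ and $n$. (2) $\mathsf{ReservoirSample}$ with parameter $k \geq 2\cdot\frac{\ln|\mathcal{R}| + \ln(2/\delta)}{\varepsilon^2}$ is $(\varepsilon,\delta)$-robust with respect to $(U,\mathcal{R})$ and $n$.
   Context: A set system is a pair $(U,\mathcal{R})$ with $\mathcal{R}\subseteq 2^U$. For a finite sequence $X=(x_1,\dots,x_m)$ of elements of $U$ (repetitions allowed) and $R\subseteq U$, the density is $d_R(X) = |\{i\in[m] : x_i\in R\}|/m$. A non-empty subsequence $S$ of $X$ is an $\varepsilon$-approximation of $X$ with respect to $(U,\mathcal{R})$ if $|d_R(X)-d_R(S)|\le\varepsilon$ for every $R\in\mathcal{R}$. Adaptive game: for rounds $i=1,\dots,n$, an adversary (computationally unbounded, possibly randomized, with a strategy fixed in advance) chooses $x_i\in U$ as a function of $x_1,\dots,x_{i-1}$ and the sampler's current state $\sigma_{i-1}$; then the sampler updates its state $\sigma_i$ from $\sigma_{i-1}$ and $x_i$; the adversary observes $\sigma_i$. The sample is $S=\sigma_n$, a subsequence of $X=(x_1,\dots,x_n)$. A sampler is $(\varepsilon,\delta)$-robust with respect to $(U,\mathcal{R})$ and $n$ if for every adversary strategy, with probability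 at least $1-\delta$ the sample $S$ is an $\varepsilon$-approximation of $X$ with respect to $(U,\mathcal{R})$. $\mathsf{BernoulliSample}$ with parameter $p\in[0,1]$: each arriving element is independently added to the sample with probability $p$ (the state is the current sample). $\mathsf{ReservoirSample}$ with parameter $k$: the first $k$ elements are stored; when the $i$-th element arrives with $i>k$, with probability $k/i$ it replaces a uniformly random one of the $k$ stored elements, and otherwise the sample is unchanged (the state is the current sample). *)

theory Defs
  imports "HOL-Probability.Probability" "HOL-Library.Sublist"
begin

definition dens :: "'a set \<Rightarrow> 'a list \<Rightarrow> real" where
  "dens R X = real (card {i. i < length X \<and> X ! i \<in> R}) / real (length X)"

definition eps_approx :: "real \<Rightarrow> 'a set set \<Rightarrow> 'a list \<Rightarrow> 'a list \<Rightarrow> bool" where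
  "eps_approx \<epsilon> \<R> X S \<longleftrightarrow>
     S \<noteq> [] \<and> subseq S X \<and> (\<forall>R\<in>\<R>. \<bar>dens R X - dens R S\<bar> \<le> \<epsilon>)"

text \<open>A sampler maps the round number \<open>i \<ge> 1\<close>, the state \<open>\<sigma>\<close> after round \<open>i - 1\<close> and the new
  element \<open>x\<close> to the distribution of the next state. The state is the current sample, listed in
  order of arrival.\<close>

type_synonym 'a sampler = "nat \<Rightarrow> 'a list \<Rightarrow> 'a \<Rightarrow> 'a list pmf"

text \<open>A deterministic adversary strategy maps the stream so far and the current state of the
  sampler to the next element.\<close>

type_synonym 'a strategy = "'a list \<Rightarrow> 'a list \<Rightarrow> 'a"

definition strategies :: "'a set \<Rightarrow> 'a strategy set" where
  "strategies U = lists U \<rightarrow> lists U \<rightarrow> U"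

text \<open>Joint distribution of the stream and the state after the given number of rounds.\<close>

primrec game :: "'a sampler \<Rightarrow> 'a strategy \<Rightarrow> nat \<Rightarrow> ('a list \<times> 'a list) pmf" where
  "game smp A 0 = return_pmf ([], [])"
| "game smp A (Suc i) =
     bind_pmf (game smp A i)
       (\<lambda>(X, \<sigma>). let x = A X \<sigma> in map_pmf (\<lambda>\<sigma>'. (X @ [x], \<sigma>')) (smp (Suc i) \<sigma> x))"

text \<open>A randomized adversary is an arbitrary probability space \<open>\<A>\<close> of deterministic strategies: all
  of its coins (for every round) are drawn in advance, independently of those of the sampler, and
  are never shown to the sampler. Drawing coins \<open>\<omega>\<close> from any other probability space and playing
  \<open>A\<^sub>\<omega>\<close> amounts to this, via the push-forward along \<open>\<omega> \<mapsto> A\<^sub>\<omega>\<close>. Point masses are the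
  deterministic adversaries. The integral is the overall success probability; since
  \<open>nn_integral\<close> is a lower integral, it remains meaningful (as an inner probability) if
  the integrand is not measurable, so no measurability has to be imposed on the adversary.\<close>

definition robust ::
  "real \<Rightarrow> real \<Rightarrow> 'a set \<Rightarrow> 'a set set \<Rightarrow> nat \<Rightarrow> 'a sampler \<Rightarrow> bool" where
  "robust \<epsilon> \<delta> U \<R> n smp \<longleftrightarrow>
     (\<forall>\<A> :: 'a strategy measure. prob_space \<A> \<and> space \<A> \<subseteq> strategies U \<longrightarrow>
        (\<integral>\<^sup>+ A. emeasure (measure_pmf (game smp A n)) {(X, S). eps_approx \<epsilon> \<R> X S} \<partial>\<A>)
          \<ge> ennreal (1 - \<delta>))"

definition bernoulli_sample :: "real \<Rightarrow> 'a sampler" where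
  "bernoulli_sample p i \<sigma> x = map_pmf (\<lambda>b. if b then \<sigma> @ [x] else \<sigma>) (bernoulli_pmf p)"

text \<open>For \<open>i > k\<close> the state has length \<open>k\<close>. The evicted element is deleted and the new one
  appended (rather than written into the vacated slot), which keeps the sample a subsequence of the
  stream.\<close>

definition reservoir_sample :: "nat \<Rightarrow> 'a sampler" where
  "reservoir_sample k i \<sigma> x =
     (if i \<le> k then return_pmf (\<sigma> @ [x])
      else bind_pmf (bernoulli_pmf (real k / real i))
        (\<lambda>b. if b then map_pmf (\<lambda>j. nths \<sigma> (- {j}) @ [x]) (pmf_of_set {..<k})
             else return_pmf \<sigma>))"

end

theory Submission
  imports Defs
begin

text \<open>For a deterministic adversary and a fixed \<open>R\<close>, let \<open>N\<close> and \<open>D\<close> be the numbers of elements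
  of \<open>R\<close> in the stream and in the sample. The processes \<open>D - p N\<close> (Bernoulli) and \<open>i D - k N\<close>
  (reservoir, rounds \<open>i \<ge> k\<close>) are martingales whatever the adversary does, because the next element
  is fixed before the sampler flips its coins. Their increments are rescaled centred Bernoulli
  variables, whose variance is proportional to the small sampling probability, so a Freedman-type
  exponential supermartingale gives the tail bounds, and a union bound over \<open>\<R>\<close> finishes. For
  Bernoulli sampling the set \<open>UNIV\<close> is added to the union bound, to control the sample size.
  Since the bound holds for each deterministic adversary, it survives averaging.\<close>

text \<open>Counting through \<open>filter\<close> lets simp evaluate the effect of appending an
  element. The counts are real because the martingales combine them with real weights.\<close>

abbreviation hits :: "'a set \<Rightarrow> 'a list \<Rightarrow> real" where
  "hits R X \<equiv> real (length (filter (\<lambda>x. x \<in> R) X))"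

lemma dens_eq_hits: "dens R X = hits R X / real (length X)"
  by (simp add: dens_def length_filter_conv_card)

lemma hits_le_length: "hits R X \<le> real (length X)"
  by simp

section \<open>Exponential moments of centred Bernoulli variables\<close>

text \<open>In the third-order Taylor remainder \<open>exp t * y ^ 3 / 6\<close>, one factor
  \<open>y\<close> is bounded by \<open>c\<close> and \<open>exp t\<close> by
  \<open>1 + c + c\<^sup>2\<close>. For small \<open>c\<close> the quadratic coefficient stays near
  1/2, which later yields explicit constants.\<close>

lemma exp_le_quadratic:
  fixes y c :: real
  assumes "\<bar>y\<bar> \<le> c" "c \<le> 1"
  shows "exp y \<le> 1 + y + (1 / 2 + c * (1 + c + c\<^sup>2) / 6) * y\<^sup>2"
proof -
  obtain t where t: "\<bar>t\<bar> \<le> \<bar>y\<bar>"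
    and eq: "exp y = (\<Sum>m<3. y ^ m / fact m) + exp t / fact 3 * y ^ 3"
    using Maclaurin_exp_le[of y 3] by blast
  have c0: "0 \<le> c" using assms by linarith
  have "exp t \<le> exp c" using t assms by simp
  also have "\<dots> \<le> 1 + c + c\<^sup>2" using exp_bound[of c] c0 assms by simp
  finally have et: "exp t \<le> 1 + c + c\<^sup>2" .
  have "exp t * y \<le> exp t * \<bar>y\<bar>" by (intro mult_left_mono) auto
  also have "\<dots> \<le> (1 + c + c\<^sup>2) * c"
    using assms c0 by (intro mult_mono et) auto
  finally have "exp t * y \<le> (1 + c + c\<^sup>2) * c" .
  then have "exp t * y * y\<^sup>2 \<le> (1 + c + c\<^sup>2) * c * y\<^sup>2"
    by (rule mult_right_mono) simp
  then show ?thesis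
    unfolding eq by (simp add: eval_nat_numeral field_simps)
qed

text \<open>For a probability \<open>q\<close>, the left side is the moment generating function at
  \<open>y\<close> of a centred Bernoulli variable. Factoring out \<open>exp (- (y * q))\<close> and
  using 1 + z \<le> exp z keeps \<open>q\<close> in the exponent, so the bound scales with the
  variance, unlike Hoeffding's lemma.\<close>

lemma bernoulli_mgf_le:
  fixes q y K :: real
  assumes "0 \<le> q" and "exp y \<le> 1 + y + K * y\<^sup>2"
  shows "q * exp (y * (1 - q)) + (1 - q) * exp (- (y * q)) \<le> exp (q * K * y\<^sup>2)"
proof -
  have "q * exp (y * (1 - q)) + (1 - q) * exp (- (y * q)) = (1 + q * (exp y - 1)) * exp (- (y * q))"
    by (simp add: algebra_simps flip: exp_add)
  also have "\<dots> \<le> exp (q * (exp y - 1)) * exp (- (y * q))"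
    by (intro mult_right_mono exp_ge_add_one_self) simp
  also have "\<dots> = exp (q * (exp y - 1 - y))"
    by (simp add: algebra_simps flip: exp_add)
  also have "q * (exp y - 1 - y) \<le> q * (K * y\<^sup>2)"
    using assms by (intro mult_left_mono) auto
  finally show ?thesis by (simp add: mult.assoc)
qed

section \<open>Exponential supermartingales along the adaptive game\<close>

text \<open>The process \<open>exp V\<close> is a supermartingale started at 1, so its mean stays at
  most 1 and Markov's inequality gives the tail. Since \<open>step\<close> holds for every next
  element \<open>x\<close>, an adaptive choice of \<open>x\<close> gains nothing.\<close>

lemma game_exp_tail:
  fixes V :: "nat \<Rightarrow> 'a list \<Rightarrow> 'a list \<Rightarrow> real"
  assumes start: "V 0 [] [] = 0"
    and step: "\<And>i X \<sigma> x. i < n \<Longrightarrow> (X, \<sigma>) \<in> set_pmf (game smp A i) \<Longrightarrow>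
      (\<integral>\<^sup>+ \<sigma>'. ennreal (exp (V (Suc i) (X @ [x]) \<sigma>')) \<partial>measure_pmf (smp (Suc i) \<sigma> x))
        \<le> ennreal (exp (V i X \<sigma>))"
  shows "measure_pmf.prob (game smp A n) {(X, S). a \<le> V n X S} \<le> exp (- a)"
proof -
  have "(\<integral>\<^sup>+ (X, S). ennreal (exp (V i X S)) \<partial>measure_pmf (game smp A i)) \<le> 1" if "i \<le> n" for i
    using that
  proof (induction i)
    case 0
    then show ?case using start by simp
  next
    case (Suc i)
    have "(\<integral>\<^sup>+ (X, S). ennreal (exp (V (Suc i) X S)) \<partial>measure_pmf (game smp A (Suc i)))
      = (\<integral>\<^sup>+ (X, \<sigma>). (\<integral>\<^sup>+ \<sigma>'. ennreal (exp (V (Suc i) (X @ [A X \<sigma>]) \<sigma>'))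
            \<partial>measure_pmf (smp (Suc i) \<sigma> (A X \<sigma>))) \<partial>measure_pmf (game smp A i))"
      by (auto simp: nn_integral_bind_pmf nn_integral_map_pmf Let_def intro!: nn_integral_cong)
    \<comment> \<open>The inner integral conditions on the position after \<open>i\<close> rounds,
      where \<open>A X \<sigma>\<close> is already determined. Comparing almost everywhere supplies
      the reachability premise of \<open>step\<close>.\<close>
    also have "\<dots> \<le> (\<integral>\<^sup>+ (X, \<sigma>). ennreal (exp (V i X \<sigma>)) \<partial>measure_pmf (game smp A i))"
      using Suc.prems by (intro nn_integral_mono_AE) (auto simp: AE_measure_pmf_iff intro!: step)
    finally show ?case using Suc by (meson Suc_leD order_trans)
  qed
  then have E: "(\<integral>\<^sup>+ (X, S). ennreal (exp (V n X S)) \<partial>measure_pmf (game smp A n)) \<le> 1"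
    by simp
  have "emeasure (measure_pmf (game smp A n)) {(X, S). a \<le> V n X S}
      = (\<integral>\<^sup>+ z. indicator {(X, S). a \<le> V n X S} z \<partial>measure_pmf (game smp A n))"
    by simp
  \<comment> \<open>Markov's inequality pointwise: on the event,
    \<open>exp (- a) * exp (V n X S)\<close> is at least 1.\<close>
  also have "\<dots> \<le> (\<integral>\<^sup>+ z. ennreal (exp (- a)) * (case z of (X, S) \<Rightarrow> ennreal (exp (V n X S)))
      \<partial>measure_pmf (game smp A n))"
    by (intro nn_integral_mono)
       (auto simp: indicator_def simp flip: ennreal_mult' exp_add ennreal_1 intro!: ennreal_leI)
  also have "\<dots> \<le> ennreal (exp (- a)) * 1"
    by (subst nn_integral_cmult) (intro borel_measurable_count_space | intro mult_left_mono E | simp)+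
  finally show ?thesis
    by (simp add: measure_pmf.emeasure_eq_measure)
qed

section \<open>Reduction to deterministic adversaries, and union bounds\<close>

text \<open>A constant lower bound, uniform over deterministic strategies, is preserved by
  integration over a probability space; monotonicity of the lower integral asks for no
  measurability.\<close>

lemma robustI:
  assumes "\<And>A. measure_pmf.prob (game smp A n) {(X, S). \<not> eps_approx \<epsilon> \<R> X S} \<le> \<delta>"
  shows "robust \<epsilon> \<delta> U \<R> n smp"
  unfolding robust_def
proof (intro allI impI)
  fix \<A> :: "'a strategy measure"
  assume \<A>: "prob_space \<A> \<and> space \<A> \<subseteq> strategies U"
  interpret prob_space \<A> using \<A> by simp
  have "ennreal (1 - \<delta>) \<le> emeasure (measure_pmf (game smp A n)) {(X, S). eps_approx \<epsilon> \<R> X S}" for A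
  proof -
    have "{(X, S). eps_approx \<epsilon> \<R> X S} = UNIV - {(X, S). \<not> eps_approx \<epsilon> \<R> X S}" by auto
    then have "measure_pmf.prob (game smp A n) {(X, S). eps_approx \<epsilon> \<R> X S} \<ge> 1 - \<delta>"
      using assms[of A] measure_pmf.prob_compl[of "{(X, S). \<not> eps_approx \<epsilon> \<R> X S}" "game smp A n"]
      by simp
    then show ?thesis
      by (simp add: measure_pmf.emeasure_eq_measure ennreal_leI)
  qed
  then have "(\<integral>\<^sup>+ A. ennreal (1 - \<delta>) \<partial>\<A>)
      \<le> (\<integral>\<^sup>+ A. emeasure (measure_pmf (game smp A n)) {(X, S). eps_approx \<epsilon> \<R> X S} \<partial>\<A>)"
    by (intro nn_integral_mono)
  then show "ennreal (1 - \<delta>)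
      \<le> (\<integral>\<^sup>+ A. emeasure (measure_pmf (game smp A n)) {(X, S). eps_approx \<epsilon> \<R> X S} \<partial>\<A>)"
    by (simp add: emeasure_space_1)
qed

text \<open>A union bound whose covering condition is checked only on the support, so that
  invariants of reachable positions can be used.\<close>

lemma prob_le_sum_of_cover:
  assumes "finite I"
    and "\<And>z. z \<in> set_pmf M \<Longrightarrow> z \<in> E \<Longrightarrow> \<exists>i\<in>I. z \<in> B i"
    and "\<And>i. i \<in> I \<Longrightarrow> measure_pmf.prob M (B i) \<le> b"
  shows "measure_pmf.prob M E \<le> real (card I) * b"
proof -
  have "measure_pmf.prob M E \<le> measure_pmf.prob M (\<Union>i\<in>I. B i)"
    using assms(2) by (intro measure_pmf.finite_measure_mono_AE) (auto simp: AE_measure_pmf_iff)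
  also have "\<dots> \<le> (\<Sum>i\<in>I. measure_pmf.prob M (B i))"
    by (intro measure_pmf.finite_measure_subadditive_finite assms) auto
  also have "\<dots> \<le> real (card I) * b"
    using sum_bounded_above[of I "\<lambda>i. measure_pmf.prob M (B i)" b] assms(3) by simp
  finally show ?thesis .
qed

lemma prob_abs_le:
  fixes f :: "'b \<Rightarrow> real"
  assumes "measure_pmf.prob M {z. a \<le> f z} \<le> b" "measure_pmf.prob M {z. a \<le> - f z} \<le> b"
  shows "measure_pmf.prob M {z. a \<le> \<bar>f z\<bar>} \<le> 2 * b"
proof -
  have "measure_pmf.prob M {z. a \<le> \<bar>f z\<bar>} \<le> measure_pmf.prob M ({z. a \<le> f z} \<union> {z. a \<le> - f z})"
    by (intro measure_pmf.finite_measure_mono) auto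
  also have "\<dots> \<le> measure_pmf.prob M {z. a \<le> f z} + measure_pmf.prob M {z. a \<le> - f z}"
    by (intro measure_Un_le) auto
  finally show ?thesis using assms by simp
qed

subsection \<open>Bernoulli sampling\<close>

lemma bernoulli_game_support:
  "(X, S) \<in> set_pmf (game (bernoulli_sample p) A i) \<Longrightarrow> length X = i \<and> subseq S X"
proof (induction i arbitrary: X S)
  case (Suc i)
  obtain X' \<sigma> where mem: "(X', \<sigma>) \<in> set_pmf (game (bernoulli_sample p) A i)"
    and X: "X = X' @ [A X' \<sigma>]" and S: "S \<in> set_pmf (bernoulli_sample p (Suc i) \<sigma> (A X' \<sigma>))"
    using Suc.prems by (auto simp: Let_def)
  have "S = \<sigma> \<or> S = \<sigma> @ [A X' \<sigma>]"
    using S by (auto simp: bernoulli_sample_def)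
  then show ?case using X Suc.IH[OF mem] by (auto intro: subseq_rev_drop_many list_emb_append_mono)
qed simp

text \<open>For \<open>x \<in> R\<close>, the difference \<open>hits R S - p * hits R X\<close>
  makes a centred Bernoulli step, whose exponential moment costs at most
  \<open>p * K * \<theta>\<^sup>2\<close>. Charging this amount in every round makes the compensator
  deterministic.\<close>

lemma bernoulli_one_sided_tail:
  fixes \<theta> p :: real
  assumes p: "0 \<le> p" "p \<le> 1" and K: "exp \<theta> \<le> 1 + \<theta> + K * \<theta>\<^sup>2" "0 \<le> K"
  shows "measure_pmf.prob (game (bernoulli_sample p) A n)
      {(X, S). a \<le> \<theta> * (hits R S - p * hits R X) - real n * p * K * \<theta>\<^sup>2} \<le> exp (- a)"
proof (rule game_exp_tail[where V = "\<lambda>i X S. \<theta> * (hits R S - p * hits R X) - real i * p * K * \<theta>\<^sup>2"])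
  fix i :: nat and X \<sigma> :: "'a list" and x :: 'a
  let ?v = "\<theta> * (hits R \<sigma> - p * hits R X) - real i * p * K * \<theta>\<^sup>2"
  let ?v' = "\<lambda>\<sigma>'. \<theta> * (hits R \<sigma>' - p * hits R (X @ [x])) - real (Suc i) * p * K * \<theta>\<^sup>2"
  have "p * exp (?v' (\<sigma> @ [x])) + (1 - p) * exp (?v' \<sigma>) \<le> exp ?v"
  proof (cases "x \<in> R")
    case True
    have "p * exp (?v' (\<sigma> @ [x])) + (1 - p) * exp (?v' \<sigma>)
        = exp (?v - p * K * \<theta>\<^sup>2) * (p * exp (\<theta> * (1 - p)) + (1 - p) * exp (- (\<theta> * p)))"
    proof -
      have "?v' (\<sigma> @ [x]) = (?v - p * K * \<theta>\<^sup>2) + \<theta> * (1 - p)"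
        "?v' \<sigma> = (?v - p * K * \<theta>\<^sup>2) + - (\<theta> * p)"
        using True by (simp_all add: algebra_simps)
      then show ?thesis by (simp only: exp_add) (simp add: algebra_simps)
    qed
    also have "\<dots> \<le> exp (?v - p * K * \<theta>\<^sup>2) * exp (p * K * \<theta>\<^sup>2)"
      using bernoulli_mgf_le[OF p(1) K(1)] by (intro mult_left_mono) auto
    finally show ?thesis by (simp flip: exp_add)
  next
    \<comment> \<open>The difference does not move here, and the compensator is charged anyway,
      which only lowers the exponent.\<close>
    case False
    then have "?v' (\<sigma> @ [x]) = ?v - p * K * \<theta>\<^sup>2" "?v' \<sigma> = ?v - p * K * \<theta>\<^sup>2"
      by (simp_all add: algebra_simps)
    then have "p * exp (?v' (\<sigma> @ [x])) + (1 - p) * exp (?v' \<sigma>) = exp (?v - p * K * \<theta>\<^sup>2)"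
      by (simp only:) (simp add: left_diff_distrib)
    also have "\<dots> \<le> exp ?v" using p K by simp
    finally show ?thesis .
  qed
  then have "ennreal (p * exp (?v' (\<sigma> @ [x])) + (1 - p) * exp (?v' \<sigma>)) \<le> ennreal (exp ?v)"
    by (rule ennreal_leI)
  then show "(\<integral>\<^sup>+ \<sigma>'. ennreal (exp (?v' \<sigma>')) \<partial>measure_pmf (bernoulli_sample p (Suc i) \<sigma> x))
      \<le> ennreal (exp ?v)"
    using p by (simp add: bernoulli_sample_def mult.commute ennreal_plus ennreal_mult'')
qed simp

text \<open>At \<open>t = \<epsilon> / 2\<close> the rate 2/5 becomes \<epsilon>^2 n p / 10, the
  source of the constant 10 in the theorem.\<close>

lemma bernoulli_deviation:
  fixes p t :: real
  assumes p: "0 \<le> p" "p \<le> 1" and t: "0 < t" "t \<le> 1 / 2"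
  shows "measure_pmf.prob (game (bernoulli_sample p) A n)
      {(X, S). t * (real n * p) \<le> \<bar>hits R S - p * hits R X\<bar>} \<le> 2 * exp (- (2 / 5 * t\<^sup>2 * (real n * p)))"
proof -
  have "measure_pmf.prob (game (bernoulli_sample p) A n)
      {z. t * (real n * p) \<le> s * (case z of (X, S) \<Rightarrow> hits R S - p * hits R X)}
      \<le> exp (- (2 / 5 * t\<^sup>2 * (real n * p)))" if s: "s = 1 \<or> s = -1" for s :: real
  proof -
    \<comment> \<open>Up to the sign \<open>s\<close>, this maximises \<theta> t - (5/8) \<theta>^2,
      with maximum (2/5) t^2.\<close>
    define \<theta> where "\<theta> = s * (4 / 5 * t)"
    have \<theta>: "\<bar>\<theta>\<bar> \<le> 2 / 5" "\<theta>\<^sup>2 = 16 / 25 * t\<^sup>2"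
      using s t by (auto simp: \<theta>_def power2_eq_square)
    have "exp \<theta> \<le> 1 + \<theta> + (1 / 2 + 2 / 5 * (1 + 2 / 5 + (2 / 5)\<^sup>2) / 6) * \<theta>\<^sup>2"
      using \<theta> by (intro exp_le_quadratic) auto
    \<comment> \<open>The coefficient is 0.604, rounded up to 5/8.\<close>
    also have "\<dots> \<le> 1 + \<theta> + 5 / 8 * \<theta>\<^sup>2"
      by (intro add_left_mono mult_right_mono) (auto simp: power2_eq_square)
    finally have K: "exp \<theta> \<le> 1 + \<theta> + 5 / 8 * \<theta>\<^sup>2" .
    let ?a = "2 / 5 * t\<^sup>2 * (real n * p)"
    have sub: "{z. t * (real n * p) \<le> s * (case z of (X, S) \<Rightarrow> hits R S - p * hits R X)}
        \<subseteq> {(X, S). ?a \<le> \<theta> * (hits R S - p * hits R X) - real n * p * (5 / 8) * \<theta>\<^sup>2}"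
    proof (rule subsetI, unfold mem_Collect_eq case_prod_unfold)
      fix z :: "'a list \<times> 'a list"
      let ?w = "hits R (snd z) - p * hits R (fst z)"
      assume "t * (real n * p) \<le> s * ?w"
      then have "(4 / 5 * t) * (t * (real n * p)) \<le> (4 / 5 * t) * (s * ?w)"
        using t by (intro mult_left_mono) auto
      also have "\<dots> = \<theta> * ?w" by (simp add: \<theta>_def)
      finally show "?a \<le> \<theta> * ?w - real n * p * (5 / 8) * \<theta>\<^sup>2"
        unfolding \<theta>(2) by (simp add: power2_eq_square algebra_simps)
    qed
    show ?thesis
      using measure_pmf.finite_measure_mono[OF sub, of "game (bernoulli_sample p) A n"]
        bernoulli_one_sided_tail[OF p K, of A n ?a R]
      by simp
  qed
  from this[of 1] this[of "-1"] show ?thesis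
    using prob_abs_le[of "game (bernoulli_sample p) A n" "t * (real n * p)"
        "\<lambda>(X, S). hits R S - p * hits R X"]
    by (simp add: case_prod_unfold)
qed

text \<open>The sample size is random, so the density error splits into the error of normalising by
  \<open>length S\<close> instead of \<open>n * p\<close> and the error of the hit count. Each takes
  \<epsilon>/2; the first is controlled by the instance \<open>UNIV\<close> of
  \<open>near\<close>.\<close>

lemma eps_approx_of_hits_near_mean:
  fixes p \<epsilon> :: real
  assumes len: "length X = n" and sub: "subseq S X" and pos: "0 < real n * p" and \<epsilon>: "0 < \<epsilon>" "\<epsilon> < 1"
    and near: "\<And>R. R \<in> insert UNIV \<R> \<Longrightarrow> \<bar>hits R S - p * hits R X\<bar> < \<epsilon> / 2 * (real n * p)"
  shows "eps_approx \<epsilon> \<R> X S"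
proof -
  let ?N = "real n * p"
  have size: "\<bar>real (length S) - ?N\<bar> < \<epsilon> / 2 * ?N"
    using near[of UNIV] len by (simp add: mult.commute)
  \<comment> \<open>The size bound also excludes an empty sample, because \<epsilon>/2 < 1.\<close>
  have "\<epsilon> / 2 * ?N < 1 * ?N" using \<epsilon> pos by (intro mult_strict_right_mono) auto
  then have m: "0 < real (length S)" using size by linarith
  have "\<bar>dens R X - dens R S\<bar> \<le> \<epsilon>" if "R \<in> \<R>" for R
  proof -
    have n0: "0 < real n" "p \<noteq> 0" using pos by (auto intro: Nat.gr0I)
    have "dens R S - dens R X
        = hits R S / length S * ((?N - length S) / ?N) + (hits R S - p * hits R X) / ?N"
      using m n0 len by (simp add: dens_eq_hits field_simps)
    also have "\<bar>\<dots>\<bar> \<le> \<bar>hits R S / length S * ((?N - length S) / ?N)\<bar> + \<bar>(hits R S - p * hits R X) / ?N\<bar>"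
      by (rule abs_triangle_ineq)
    also have "\<dots> \<le> 1 * (\<epsilon> / 2) + \<epsilon> / 2"
    proof (rule add_mono)
      have "\<bar>hits R S / length S\<bar> \<le> 1" using m by (simp add: field_simps)
      moreover have "\<bar>(?N - length S) / ?N\<bar> \<le> \<epsilon> / 2"
        using size pos unfolding abs_divide by (simp add: pos_divide_le_eq abs_minus_commute)
      ultimately show "\<bar>hits R S / length S * ((?N - length S) / ?N)\<bar> \<le> 1 * (\<epsilon> / 2)"
        unfolding abs_mult by (intro mult_mono) auto
      show "\<bar>(hits R S - p * hits R X) / ?N\<bar> \<le> \<epsilon> / 2"
        using near[of R] that pos unfolding abs_divide by (simp add: pos_divide_le_eq)
    qed
    finally show ?thesis by (simp add: abs_minus_commute)
  qed
  then show ?thesis using sub m by (auto simp: eps_approx_def)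
qed

lemma exp_neg_ln_card_le:
  fixes \<delta> c L :: real
  assumes "0 < \<delta>" "0 < c" "ln (real m) + ln (c / \<delta>) \<le> L"
  shows "exp (- L) \<le> \<delta> / (c * real (max 1 m))"
proof -
  have "exp (- L) \<le> exp (- (ln (real (max 1 m)) + ln (c / \<delta>)))"
    \<comment> \<open>For \<open>m = 0\<close> the convention \<open>ln 0 = 0\<close> makes the
      hypothesis agree with that for \<open>m = 1\<close>, hence \<open>max 1 m\<close>.\<close>
    using assms by (cases "m = 0") (auto simp: max_def)
  also have "\<dots> = \<delta> / (c * real (max 1 m))"
    using assms by (simp only: exp_minus exp_add) (simp add: field_simps)
  finally show ?thesis .
qed

text \<open>The 4 in \<open>ln (4 / \<delta>)\<close> pays a factor 2 for the two tails and a factor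
  2 for adding \<open>UNIV\<close> to the union bound.\<close>

lemma bernoulli_robust:
  fixes \<epsilon> \<delta> p :: real and \<R> :: "'a set set"
  assumes \<epsilon>: "0 < \<epsilon>" "\<epsilon> < 1" and \<delta>: "0 < \<delta>" "\<delta> < 1" and fin: "finite \<R>" and n: "1 \<le> n"
    and p: "0 \<le> p" "p \<le> 1"
    and pge: "10 * ((ln (real (card \<R>)) + ln (4 / \<delta>)) / (\<epsilon>\<^sup>2 * real n)) \<le> p"
  shows "robust \<epsilon> \<delta> U \<R> n (bernoulli_sample p)"
proof (rule robustI)
  fix A :: "'a strategy"
  let ?G = "game (bernoulli_sample p) A n"
  let ?L = "2 / 5 * (\<epsilon> / 2)\<^sup>2 * (real n * p)"
  have en: "0 < \<epsilon>\<^sup>2 * real n" using \<epsilon> n by simp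
  have "0 \<le> ln (real (card \<R>))" by (cases "card \<R> = 0") auto
  moreover have "0 < ln (4 / \<delta>)" using \<delta> by (simp add: field_simps)
  ultimately have sum_pos: "0 < ln (real (card \<R>)) + ln (4 / \<delta>)" by simp
  \<comment> \<open>Positivity of \<open>p\<close> comes from the assumed lower bound, whose
    numerator is positive because \<delta> < 4.\<close>
  then have "0 < p" using pge en by (smt (verit) divide_pos_pos)
  then have np: "0 < real n * p" using n by simp
  have L: "ln (real (card \<R>)) + ln (4 / \<delta>) \<le> ?L"
    using pge en by (simp add: field_simps power2_eq_square)
  let ?b = "\<delta> / (4 * real (max 1 (card \<R>)))"
  have b: "exp (- ?L) \<le> ?b"
    using exp_neg_ln_card_le[OF \<delta>(1) _ L] by simp
  have "measure_pmf.prob ?G {(X, S). \<not> eps_approx \<epsilon> \<R> X S}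
      \<le> real (card (insert UNIV \<R>)) * (2 * ?b)"
  proof (rule prob_le_sum_of_cover[where
        B = "\<lambda>R. {(X, S). \<epsilon> / 2 * (real n * p) \<le> \<bar>hits R S - p * hits R X\<bar>}"])
    fix z assume z: "z \<in> set_pmf ?G" "z \<in> {(X, S). \<not> eps_approx \<epsilon> \<R> X S}"
    obtain X S where zXS: "z = (X, S)" by (cases z)
    have XS: "length X = n" "subseq S X"
      using bernoulli_game_support[of X S p A n] z by (auto simp: zXS)
    have "\<exists>R\<in>insert UNIV \<R>. \<epsilon> / 2 * (real n * p) \<le> \<bar>hits R S - p * hits R X\<bar>"
    proof (rule ccontr)
      assume "\<not> ?thesis"
      then have "eps_approx \<epsilon> \<R> X S"
        by (intro eps_approx_of_hits_near_mean[OF XS np \<epsilon>]) (meson not_le)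
      then show False using z by (simp add: zXS)
    qed
    then show "\<exists>R\<in>insert UNIV \<R>. z \<in> {(X, S). \<epsilon> / 2 * (real n * p) \<le> \<bar>hits R S - p * hits R X\<bar>}"
      by (simp add: zXS)
  next
    fix R
    show "measure_pmf.prob ?G {(X, S). \<epsilon> / 2 * (real n * p) \<le> \<bar>hits R S - p * hits R X\<bar>} \<le> 2 * ?b"
      using bernoulli_deviation[OF p, of "\<epsilon> / 2" A n R] \<epsilon> b by linarith
  qed (use fin in simp)
  \<comment> \<open>At most \<open>card \<R> + 1\<close> sets occur, which is at most twice
    \<open>max 1 (card \<R>)\<close>, even for empty \<open>\<R>\<close>.\<close>
  also have "\<dots> \<le> (2 * real (max 1 (card \<R>))) * (2 * ?b)"
    using card_insert_le_m1[of "Suc (card \<R>)" \<R> UNIV] \<delta> by (intro mult_right_mono) auto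
  also have "\<dots> = \<delta>" by simp
  finally show "measure_pmf.prob ?G {(X, S). \<not> eps_approx \<epsilon> \<R> X S} \<le> \<delta>" .
qed

subsection \<open>Reservoir sampling\<close>

lemma hits_nths_delete:
  assumes "j < length \<sigma>"
  shows "hits R (nths \<sigma> (- {j})) = hits R \<sigma> - of_bool (\<sigma> ! j \<in> R)"
  using assms
proof (induction \<sigma> arbitrary: j)
  case (Cons a \<sigma>)
  show ?case
  proof (cases j)
    case 0
    have "{i. Suc i \<in> - {0::nat}} = UNIV" by auto
    then show ?thesis using 0 by (simp add: nths_Cons nths_all)
  next
    case (Suc j')
    have "{i. Suc i \<in> - {Suc j'}} = - {j'}" by auto
    then show ?thesis using Suc Cons by (auto simp: nths_Cons)
  qed
qed simp

lemma length_nths_delete: "j < length \<sigma> \<Longrightarrow> length (nths \<sigma> (- {j})) = length \<sigma> - 1"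
  using hits_nths_delete[of j \<sigma> UNIV] by simp

text \<open>The last clause settles streams shorter than the reservoir, where the sample is the
  whole stream. Deleting and then appending preserves the subsequence relation.\<close>

lemma reservoir_game_support:
  assumes "0 < k" "(X, S) \<in> set_pmf (game (reservoir_sample k) A i)"
  shows "length X = i \<and> length S = min i k \<and> subseq S X \<and> (i \<le> k \<longrightarrow> S = X)"
  using assms(2)
proof (induction i arbitrary: X S)
  case (Suc i)
  obtain X' \<sigma> where mem: "(X', \<sigma>) \<in> set_pmf (game (reservoir_sample k) A i)"
    and X: "X = X' @ [A X' \<sigma>]" and S: "S \<in> set_pmf (reservoir_sample k (Suc i) \<sigma> (A X' \<sigma>))"
    using Suc.prems by (auto simp: Let_def)
  from Suc.IH[OF mem]
  have IH: "length X' = i" "length \<sigma> = min i k" "subseq \<sigma> X'" "i \<le> k \<Longrightarrow> \<sigma> = X'"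
    by simp_all
  show ?case
  proof (cases "Suc i \<le> k")
    case True
    then show ?thesis using IH X S by (auto simp: reservoir_sample_def)
  next
    case False
    then consider "S = \<sigma>" | j where "j < k" "S = nths \<sigma> (- {j}) @ [A X' \<sigma>]"
      using S \<open>0 < k\<close> by (auto simp: reservoir_sample_def set_pmf_of_set lessThan_empty_iff split: if_splits)
    then show ?thesis
    proof cases
      case 1
      then show ?thesis using IH X False by (auto intro: subseq_order.order_trans)
    next
      case 2
      have "subseq (nths \<sigma> (- {j})) X'"
        using IH(3) subseq_order.order_trans subseq_conv_nths by blast
      then show ?thesis
        using 2 IH X False \<open>0 < k\<close> by (auto simp: length_nths_delete intro: list_emb_append_mono)
    qed
  qed
qed simp

lemma sum_over_hits:
  fixes g :: "bool \<Rightarrow> real"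
  shows "(\<Sum>j<length \<sigma>. g (\<sigma> ! j \<in> R)) = hits R \<sigma> * g True + (real (length \<sigma>) - hits R \<sigma>) * g False"
proof -
  have "(\<Sum>j<length \<sigma>. g (\<sigma> ! j \<in> R))
      = (\<Sum>j<length \<sigma>. of_bool (\<sigma> ! j \<in> R) * (g True - g False) + g False)"
    by (intro sum.cong) auto
  also have "\<dots> = (\<Sum>j<length \<sigma>. of_bool (\<sigma> ! j \<in> R)) * (g True - g False) + length \<sigma> * g False"
    by (simp add: sum.distrib sum_distrib_right)
  also have "(\<Sum>j<length \<sigma>. of_bool (\<sigma> ! j \<in> R)) = hits R \<sigma>"
    by (simp add: length_filter_conv_card Int_def)
  finally show ?thesis by (simp add: algebra_simps)
qed

text \<open>Whichever element is evicted, the number of hits can only move in the direction \<open>s\<close>, by one;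
  so although the state evolves in a complicated way, this number makes a Bernoulli step.\<close>

lemma nn_integral_reservoir_hits:
  fixes f :: "real \<Rightarrow> real" and R :: "'a set" and x :: 'a
  assumes f: "\<And>d. 0 \<le> f d" and k: "0 < k" "k < i" "length \<sigma> = k"
  defines "q \<equiv> (if x \<in> R then real k - hits R \<sigma> else hits R \<sigma>) / real i"
    and "s \<equiv> (if x \<in> R then 1 else - 1 :: real)"
  shows "(\<integral>\<^sup>+ \<sigma>'. ennreal (f (hits R \<sigma>')) \<partial>measure_pmf (reservoir_sample k i \<sigma> x))
      = ennreal (q * f (hits R \<sigma> + s) + (1 - q) * f (hits R \<sigma>))"
proof -
  let ?D = "hits R \<sigma>"
  let ?g = "\<lambda>b. f (?D - of_bool b + of_bool (x \<in> R))"
  have step: "hits R (nths \<sigma> (- {j}) @ [x]) = ?D - of_bool (\<sigma> ! j \<in> R) + of_bool (x \<in> R)"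
    if "j < k" for j
    using that hits_nths_delete[of j \<sigma> R] k by simp
  let ?N = "?D * ?g True + (real k - ?D) * ?g False"
  have "(\<Sum>j<k. ennreal (f (hits R (nths \<sigma> (- {j}) @ [x])))) = (\<Sum>j<k. ennreal (?g (\<sigma> ! j \<in> R)))"
    by (intro sum.cong) (simp_all only: step lessThan_iff)
  also have "\<dots> = ennreal (\<Sum>j<k. ?g (\<sigma> ! j \<in> R))"
    using f by (intro sum_ennreal) auto
  also have "(\<Sum>j<k. ?g (\<sigma> ! j \<in> R)) = ?D * ?g True + (real k - ?D) * ?g False"
    using sum_over_hits[of ?g \<sigma> R] k by simp
  finally have sum: "(\<Sum>j<k. ennreal (f (hits R (nths \<sigma> (- {j}) @ [x]))))
      = ennreal ?N" .
  have le: "?D \<le> real k" using hits_le_length[of R \<sigma>] k by simp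
  have N0: "0 \<le> ?N" using f le by (intro add_nonneg_nonneg mult_nonneg_nonneg) auto
  have ne: "{..<k} \<noteq> {}" using k by auto
  have "(\<integral>\<^sup>+ \<sigma>'. ennreal (f (hits R \<sigma>')) \<partial>measure_pmf (reservoir_sample k i \<sigma> x))
      = (\<Sum>j<k. ennreal (f (hits R (nths \<sigma> (- {j}) @ [x])))) / ennreal (real k) * ennreal (real k / real i)
        + ennreal (f ?D) * ennreal (1 - real k / real i)"
    using k ne by (simp add: reservoir_sample_def nn_integral_bind_pmf nn_integral_pmf_of_set ennreal_of_nat_eq_real_of_nat)
  also have "\<dots> = ennreal (?N / real k * (real k / real i)
        + f ?D * (1 - real k / real i))"
  proof -
    have "ennreal N / ennreal (real k) * ennreal (real k / real i) + ennreal (f ?D) * ennreal (1 - real k / real i)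
        = ennreal (N / real k * (real k / real i) + f ?D * (1 - real k / real i))"
      if "0 \<le> N" for N
      using that f[of ?D] k
      by (subst ennreal_plus) (auto simp: divide_ennreal simp flip: ennreal_mult'' times_divide_eq_left)
    then show ?thesis unfolding sum using N0 .
  qed
  \<comment> \<open>The replacement probability \<open>k / i\<close> times the uniform weight
    \<open>1 / k\<close> leaves \<open>1 / i\<close> for each stored element, so \<open>q\<close>
    counts the elements whose eviction changes the hit count.\<close>
  also have "?N / real k * (real k / real i)
        + f ?D * (1 - real k / real i) = q * f (?D + s) + (1 - q) * f ?D"
    using k by (auto simp: q_def s_def field_simps)
  finally show ?thesis .
qed

text \<open>In round j > k the martingale makes a centred Bernoulli step scaled by \<plusminus>j,
  with jump probability at most k/j. Its cost is thus at most K k \<theta>^2 j, linear in j, and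
  summing j from k + 1 to n gives the compensator. Since j \<le> n, the quadratic bound on
  \<open>exp\<close> is required up to \<open>\<bar>\<theta>\<bar> * real n\<close>.\<close>

lemma reservoir_one_sided_tail:
  fixes \<theta> K a :: real and k n :: nat
  assumes k: "0 < k" "k \<le> n" and K0: "0 \<le> K"
    and K: "\<And>y. \<bar>y\<bar> \<le> \<bar>\<theta>\<bar> * real n \<Longrightarrow> exp y \<le> 1 + y + K * y\<^sup>2"
  shows "measure_pmf.prob (game (reservoir_sample k) A n)
      {(X, S). a \<le> \<theta> * (real n * hits R S - real k * hits R X)
        - K * real k * \<theta>\<^sup>2 * (real n * (real n + 1) - real k * (real k + 1)) / 2} \<le> exp (- a)"
proof -
  \<comment> \<open>With \<open>max i k\<close> in place of \<open>i\<close>, the exponent stays constant while the reservoir fills up.\<close>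
  define V where "V i X S = \<theta> * (real (max i k) * hits R S - real k * hits R X)
      - K * real k * \<theta>\<^sup>2 * (real (max i k) * (real (max i k) + 1) - real k * (real k + 1)) / 2"
    for i :: nat and X S :: "'a list"
  have "measure_pmf.prob (game (reservoir_sample k) A n) {(X, S). a \<le> V n X S} \<le> exp (- a)"
  proof (rule game_exp_tail)
    fix i :: nat and X \<sigma> :: "'a list" and x :: 'a
    assume i: "i < n" and supp: "(X, \<sigma>) \<in> set_pmf (game (reservoir_sample k) A i)"
    show "(\<integral>\<^sup>+ \<sigma>'. ennreal (exp (V (Suc i) (X @ [x]) \<sigma>')) \<partial>measure_pmf (reservoir_sample k (Suc i) \<sigma> x))
        \<le> ennreal (exp (V i X \<sigma>))"
    proof (cases "Suc i \<le> k")
      case True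
      then have "V (Suc i) (X @ [x]) (\<sigma> @ [x]) = V i X \<sigma>"
        by (simp add: V_def max_def algebra_simps)
      then show ?thesis using True by (simp add: reservoir_sample_def)
    next
      case False
      then have len: "length \<sigma> = k" using reservoir_game_support[OF k(1) supp] by simp
      let ?D = "hits R \<sigma>"
      define j where "j = real (Suc i)"
      define s :: real where "s = (if x \<in> R then 1 else -1)"
      define q where "q = (if x \<in> R then real k - ?D else ?D) / j"
      define y where "y = s * \<theta> * j"
      define C where "C = K * real k * \<theta>\<^sup>2 * j"
      define f where "f d = exp (\<theta> * (j * d - real k * hits R (X @ [x]))
        - K * real k * \<theta>\<^sup>2 * (j * (j + 1) - real k * (real k + 1)) / 2)" for d
      have j: "0 < j" "j \<le> real n" using i by (auto simp: j_def)
      have D: "?D \<le> real k" using hits_le_length[of R \<sigma>] len by simp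
      have q: "0 \<le> q" "q * j \<le> real k" using D j by (auto simp: q_def)
      have qj: "q * j = (if x \<in> R then real k - ?D else ?D)" using j by (simp add: q_def)
      have "\<bar>y\<bar> = \<bar>\<theta>\<bar> * j" using j by (simp add: y_def s_def abs_mult)
      then have "\<bar>y\<bar> \<le> \<bar>\<theta>\<bar> * real n" using j by (simp add: mult_left_mono)
      then have mgf: "q * exp (y * (1 - q)) + (1 - q) * exp (- (y * q)) \<le> exp (q * K * y\<^sup>2)"
        by (intro bernoulli_mgf_le q K)
      have y2: "y\<^sup>2 = \<theta>\<^sup>2 * j * j" by (simp add: y_def s_def power2_eq_square)
      \<comment> \<open>One of the two factors \<open>j\<close> in \<open>y\<^sup>2\<close> is
        absorbed by \<open>q * j \<le> k\<close>.\<close>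
      have "q * K * y\<^sup>2 = (q * j) * (K * \<theta>\<^sup>2 * j)" unfolding y2 by (simp add: algebra_simps)
      also have "\<dots> \<le> real k * (K * \<theta>\<^sup>2 * j)"
        using q K0 j by (intro mult_right_mono) auto
      finally have var: "q * K * y\<^sup>2 \<le> C" by (simp add: C_def algebra_simps)
      have yq: "y * q = s * \<theta> * (q * j)" by (simp add: y_def)
      \<comment> \<open>Here \<open>i \<ge> k\<close>, so the maximum is \<open>i\<close>, which is
        \<open>j - 1\<close>.\<close>
      have V: "V i X \<sigma> = \<theta> * ((j - 1) * ?D - real k * hits R X)
        - K * real k * \<theta>\<^sup>2 * ((j - 1) * j - real k * (real k + 1)) / 2"
        using max_absorb1[of k i] False by (simp add: V_def j_def algebra_simps)
      \<comment> \<open>The change of weight from \<open>j - 1\<close> to \<open>j\<close>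
        contributes \<open>\<theta> * ?D\<close>; together with the growth of the stream count it is
        exactly the centring term \<open>- (y * q)\<close>, for either membership of
        \<open>x\<close>.\<close>
      have f0: "f ?D = exp (V i X \<sigma> - C) * exp (- (y * q))"
        unfolding f_def V yq qj C_def s_def exp_add[symmetric]
        by (rule arg_cong[where f = exp]) (simp add: field_simps)
      have f1: "f (?D + s) = exp (V i X \<sigma> - C) * exp (y * (1 - q))"
        unfolding f_def V right_diff_distrib[of y] yq qj C_def exp_add[symmetric]
        by (rule arg_cong[where f = exp]) (simp add: field_simps s_def y_def)
      have "V (Suc i) (X @ [x]) \<sigma>' = \<theta> * (j * hits R \<sigma>' - real k * hits R (X @ [x]))
        - K * real k * \<theta>\<^sup>2 * (j * (j + 1) - real k * (real k + 1)) / 2" for \<sigma>'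
        using False by (simp add: V_def j_def max_def)
      then have "(\<integral>\<^sup>+ \<sigma>'. ennreal (exp (V (Suc i) (X @ [x]) \<sigma>')) \<partial>measure_pmf (reservoir_sample k (Suc i) \<sigma> x))
          = (\<integral>\<^sup>+ \<sigma>'. ennreal (f (hits R \<sigma>')) \<partial>measure_pmf (reservoir_sample k (Suc i) \<sigma> x))"
        by (simp add: f_def)
      also have "\<dots> = ennreal (q * f (?D + s) + (1 - q) * f ?D)"
        unfolding q_def s_def j_def using k(1) False len
        by (intro nn_integral_reservoir_hits) (auto simp: f_def)
      also have "q * f (?D + s) + (1 - q) * f ?D
          = exp (V i X \<sigma> - C) * (q * exp (y * (1 - q)) + (1 - q) * exp (- (y * q)))"
        unfolding f0 f1 by (simp add: algebra_simps)
      also have "\<dots> \<le> exp (V i X \<sigma> - C) * exp C"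
        using mgf var by (intro mult_left_mono) (auto intro: order_trans)
      also have "\<dots> = exp (V i X \<sigma>)" by (simp flip: exp_add)
      finally show ?thesis by (simp add: ennreal_leI)
    qed
  qed (simp add: V_def)
  then show ?thesis using k by (simp add: V_def max_def)
qed

text \<open>The threshold is a density error \<epsilon> multiplied by \<open>n * k\<close>; the rate
  \<epsilon>^2 k / 2 matches the constant 2 in the theorem.\<close>

lemma reservoir_deviation:
  fixes \<epsilon> :: real
  assumes k: "2 \<le> k" "k \<le> n" and \<epsilon>: "0 < \<epsilon>" "\<epsilon> \<le> 1"
  shows "measure_pmf.prob (game (reservoir_sample k) A n)
      {(X, S). \<epsilon> * (real n * real k) \<le> \<bar>real n * hits R S - real k * hits R X\<bar>}
      \<le> 2 * exp (- (\<epsilon>\<^sup>2 * real k / 2))"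
proof -
  have n0: "0 < real n" using k by simp
  \<comment> \<open>The factor \<open>25 / 24\<close> absorbs the lower-order terms of the variance sum; this needs \<open>k \<ge> 2\<close>.\<close>
  have "6 \<le> real k * (real k + 1)"
    using mult_mono[of 2 "real k" 3 "real k + 1"] k by simp
  \<comment> \<open>The slack n^2/24 - n + 6 equals (n - 12)^2/24.\<close>
  moreover have "0 \<le> (real n - 12)\<^sup>2" by simp
  ultimately have quad: "real n * (real n + 1) - real k * (real k + 1) \<le> 25 / 24 * (real n)\<^sup>2"
    by (simp add: power2_eq_square algebra_simps)
  have "measure_pmf.prob (game (reservoir_sample k) A n)
      {z. \<epsilon> * (real n * real k) \<le> s * (case z of (X, S) \<Rightarrow> real n * hits R S - real k * hits R X)}
      \<le> exp (- (\<epsilon>\<^sup>2 * real k / 2))" if s: "s = 1 \<or> s = -1" for s :: real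
  proof -
    \<comment> \<open>The gain (4/5) \<epsilon>^2 k minus the compensator, at most (3/10)
      \<epsilon>^2 k, leaves \<epsilon>^2 k / 2. The factor 4/5 also keeps the argument of
      \<open>exp\<close> within 4/5, where the coefficient 9/10 is valid.\<close>
    define \<theta> where "\<theta> = s * (4 / 5 * \<epsilon> / real n)"
    have \<theta>: "\<bar>\<theta>\<bar> * real n \<le> 4 / 5" "\<theta>\<^sup>2 * (real n)\<^sup>2 = 16 / 25 * \<epsilon>\<^sup>2"
      using s \<epsilon> n0 by (auto simp: \<theta>_def power2_eq_square abs_mult)
    have K: "exp y \<le> 1 + y + 9 / 10 * y\<^sup>2" if "\<bar>y\<bar> \<le> \<bar>\<theta>\<bar> * real n" for y :: real
    proof -
      have "exp y \<le> 1 + y + (1 / 2 + 4 / 5 * (1 + 4 / 5 + (4 / 5)\<^sup>2) / 6) * y\<^sup>2"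
        using \<theta> that by (intro exp_le_quadratic) auto
      also have "\<dots> \<le> 1 + y + 9 / 10 * y\<^sup>2"
        by (intro add_left_mono mult_right_mono) (auto simp: power2_eq_square)
      finally show ?thesis .
    qed
    let ?v = "9 / 10 * real k * \<theta>\<^sup>2 * (real n * (real n + 1) - real k * (real k + 1)) / 2"
    have "?v \<le> 9 / 10 * real k * \<theta>\<^sup>2 * (25 / 24 * (real n)\<^sup>2) / 2"
      using quad by (intro divide_right_mono mult_left_mono) auto
    also have "\<dots> = 15 / 32 * real k * (\<theta>\<^sup>2 * (real n)\<^sup>2)" by simp
    finally have v: "?v \<le> 3 / 10 * \<epsilon>\<^sup>2 * real k" unfolding \<theta> by simp
    have sub: "{z. \<epsilon> * (real n * real k) \<le> s * (case z of (X, S) \<Rightarrow> real n * hits R S - real k * hits R X)}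
        \<subseteq> {(X, S). \<epsilon>\<^sup>2 * real k / 2 \<le> \<theta> * (real n * hits R S - real k * hits R X) - ?v}"
    proof (rule subsetI, unfold mem_Collect_eq case_prod_unfold)
      fix z :: "'a list \<times> 'a list"
      let ?w = "real n * hits R (snd z) - real k * hits R (fst z)"
      assume "\<epsilon> * (real n * real k) \<le> s * ?w"
      then have "(4 / 5 * \<epsilon> / real n) * (\<epsilon> * (real n * real k)) \<le> (4 / 5 * \<epsilon> / real n) * (s * ?w)"
        using \<epsilon> by (intro mult_left_mono) auto
      also have "\<dots> = \<theta> * ?w" by (simp add: \<theta>_def)
      also have "(4 / 5 * \<epsilon> / real n) * (\<epsilon> * (real n * real k)) = 4 / 5 * \<epsilon>\<^sup>2 * real k"
        using n0 by (simp add: power2_eq_square)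
      finally show "\<epsilon>\<^sup>2 * real k / 2 \<le> \<theta> * ?w - ?v" using v by linarith
    qed
    have k0: "0 < k" using k by simp
    show ?thesis
      using measure_pmf.finite_measure_mono[OF sub, of "game (reservoir_sample k) A n"]
        reservoir_one_sided_tail[OF k0 k(2) _ K, where \<theta> = \<theta> and A = A and a = "\<epsilon>\<^sup>2 * real k / 2" and R = R]
      by simp
  qed
  from this[of 1] this[of "-1"] show ?thesis
    using prob_abs_le[of "game (reservoir_sample k) A n" "\<epsilon> * (real n * real k)"
        "\<lambda>(X, S). real n * hits R S - real k * hits R X"]
    by (simp add: case_prod_unfold)
qed

text \<open>For \<open>k \<le> n\<close> the sample size is exactly \<open>k\<close>, so the union
  bound runs over \<open>\<R>\<close> alone, and the 2 in \<open>ln (2 / \<delta>)\<close> pays for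
  the two tails.\<close>

lemma reservoir_robust:
  fixes \<epsilon> \<delta> :: real and \<R> :: "'a set set"
  assumes \<epsilon>: "0 < \<epsilon>" "\<epsilon> < 1" and \<delta>: "0 < \<delta>" "\<delta> < 1" and fin: "finite \<R>" and n: "1 \<le> n"
    and kge: "2 * ((ln (real (card \<R>)) + ln (2 / \<delta>)) / \<epsilon>\<^sup>2) \<le> real k"
  shows "robust \<epsilon> \<delta> U \<R> n (reservoir_sample k)"
proof (rule robustI)
  fix A :: "'a strategy"
  let ?G = "game (reservoir_sample k) A n"
  let ?L = "\<epsilon>\<^sup>2 * real k / 2"
  have e2: "0 < \<epsilon>\<^sup>2" "\<epsilon>\<^sup>2 \<le> 1" using \<epsilon> by (auto simp: power_le_one)
  have L: "ln (real (card \<R>)) + ln (2 / \<delta>) \<le> ?L"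
    using kge e2 by (simp add: field_simps)
  have "0 \<le> ln (real (card \<R>))" by (cases "card \<R> = 0") auto
  moreover have "ln 2 \<le> ln (2 / \<delta>)" using \<delta> by (simp add: field_simps)
  \<comment> \<open>From ln 2 \<ge> 2/3 follows k \<ge> 4/3, hence k \<ge> 2 by integrality, as the
    deviation bound requires.\<close>
  ultimately have "2 / 3 \<le> ?L" using L ln2_ge_two_thirds by linarith
  moreover have "\<epsilon>\<^sup>2 * real k \<le> 1 * real k" using e2 by (intro mult_right_mono) auto
  ultimately have k2: "2 \<le> k" by linarith
  show "measure_pmf.prob ?G {(X, S). \<not> eps_approx \<epsilon> \<R> X S} \<le> \<delta>"
  proof (cases "k \<le> n")
    case False
    \<comment> \<open>The whole non-empty stream is stored, so failure is impossible: the bad event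
      is covered by an empty family.\<close>
    have "measure_pmf.prob ?G {(X, S). \<not> eps_approx \<epsilon> \<R> X S} \<le> real (card ({} :: unit set)) * 0"
      using reservoir_game_support[of k _ _ A n] k2 n False \<epsilon>
      by (intro prob_le_sum_of_cover[where B = "\<lambda>_. {}"]) (fastforce simp: eps_approx_def)+
    then show ?thesis using \<delta> by simp
  next
    case True
    let ?b = "\<delta> / (2 * real (max 1 (card \<R>)))"
    have b: "exp (- ?L) \<le> ?b"
      using exp_neg_ln_card_le[OF \<delta>(1) _ L] by simp
    have "measure_pmf.prob ?G {(X, S). \<not> eps_approx \<epsilon> \<R> X S} \<le> real (card \<R>) * (2 * ?b)"
    proof (rule prob_le_sum_of_cover[where
          B = "\<lambda>R. {(X, S). \<epsilon> * (real n * real k) \<le> \<bar>real n * hits R S - real k * hits R X\<bar>}"])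
      fix z assume z: "z \<in> set_pmf ?G" "z \<in> {(X, S). \<not> eps_approx \<epsilon> \<R> X S}"
      obtain X S where zXS: "z = (X, S)" by (cases z)
      have supp: "length X = n" "length S = k" "subseq S X"
        using reservoir_game_support[of k X S A n] z k2 True by (auto simp: zXS)
      then have "S \<noteq> []" using k2 by auto
      then obtain R where R: "R \<in> \<R>" "\<epsilon> < \<bar>dens R X - dens R S\<bar>"
        using z supp by (auto simp: zXS eps_approx_def not_le)
      have "\<epsilon> * (real n * real k) \<le> \<bar>dens R X - dens R S\<bar> * (real n * real k)"
        using R by (intro mult_right_mono) auto
      also have "\<dots> = \<bar>(dens R X - dens R S) * (real n * real k)\<bar>" by (simp add: abs_mult)
      also have "(dens R X - dens R S) * (real n * real k) = - (real n * hits R S - real k * hits R X)"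
        using supp n k2 by (simp add: dens_eq_hits field_simps)
      also have "\<bar>- (real n * hits R S - real k * hits R X)\<bar> = \<bar>real n * hits R S - real k * hits R X\<bar>"
        by (rule abs_minus_cancel)
      finally show "\<exists>R\<in>\<R>. z \<in> {(X, S). \<epsilon> * (real n * real k) \<le> \<bar>real n * hits R S - real k * hits R X\<bar>}"
        using R by (auto simp: zXS)
    next
      fix R
      show "measure_pmf.prob ?G
          {(X, S). \<epsilon> * (real n * real k) \<le> \<bar>real n * hits R S - real k * hits R X\<bar>} \<le> 2 * ?b"
        using reservoir_deviation[OF k2 True, of \<epsilon> A R] \<epsilon> b by linarith
    qed (rule fin)
    also have "\<dots> \<le> real (max 1 (card \<R>)) * (2 * ?b)"
      using \<delta> by (intro mult_right_mono) auto
    also have "\<dots> = \<delta>" by simp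
    finally show ?thesis .
  qed
qed

theorem theorem1p1:
  fixes \<epsilon> \<delta> p :: real and U :: "'a set" and \<R> :: "'a set set" and n k :: nat
  assumes "0 < \<epsilon>" "\<epsilon> < 1" "0 < \<delta>" "\<delta> < 1"
    and "\<R> \<subseteq> Pow U" "finite \<R>"
    and "1 \<le> n"
  shows "(0 \<le> p \<and> p \<le> 1 \<and> p \<ge> 10 * ((ln (real (card \<R>)) + ln (4 / \<delta>)) / (\<epsilon>\<^sup>2 * real n))
            \<longrightarrow> robust \<epsilon> \<delta> U \<R> n (bernoulli_sample p))
       \<and> (real k \<ge> 2 * ((ln (real (card \<R>)) + ln (2 / \<delta>)) / \<epsilon>\<^sup>2)
            \<longrightarrow> robust \<epsilon> \<delta> U \<R> n (reservoir_sample k))"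
  using bernoulli_robust[OF assms(1-4,6,7), of p U] reservoir_robust[OF assms(1-4,6,7), of k U]
  by blast

end
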